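(* Let $\rho:[0,1]\to\mathcal{P}_+(G)$ be a geodesic of $(\mathcal{P}_+(G),g_W)$ connecting $\rho^0$ and $\rho^1$. The Jacobi equation of $h(t)$ along the geodesic $\rho(t)$ with $h(0)=h(1)=0$ is $$\dot h-L(h)L(\rho)^\dagger\dot\rho=0,\qquad h(0)=h(1)=0;$$ that is, a smooth $h:[0,1]\to\mathbb{R}^n$ with $\sum_i h_i(t)=0$ and $h(0)=h(1)=0$ solves the Jacobi equation along $\rho$ if and only if $\dot h=L(h)L(\rho)^\dagger\dot\rho$ on $[0,1]$.
   Context: $G=(V,E,\omega)$ is a connected, weighted, undirected finite graph with vertex set $V=\{1,\dots,n\}$, edge set $E$ and weights $\omega_{ij}=\omega_{ji}>0$ if $(i,j)\in E$, $\omega_{ij}=0$ otherwise; $N(i)=\{j:(i,j)\in E\}$. For $a\in\mathbb{R}^n$ put $\theta_{ij}(a)=\frac{a_i+a_j}{2}$; the linear weighted Laplacian matrix $L(a)\in\mathbb{R}^{n\times n}$ is given by $(L(a)\Phi)(i)=\sum_{j\in N(i)}\omega_{ij}\theta_{ij}(a)(\Phi(i)-\Phi(j))$. $A^\dagger$ is the Moore-Penrose pseudo-inverse. $\mathcal{P}_+(G)=\{\rho\in\mathbb{R}^n:\sum_i\rho_i=1,\ \rho_i>0\}$, with tangent space $T_\rho\mathcal{P}_+(G)=\{\sigma\in\mathbb{R}^n:\sum_i\sigma_i=0\}$, carries the Riemannian metric $g_W(\sigma_1,\sigma_2)=\sigma_1^{\mathsf T}L(\rho)^\dagger\sigma_2$.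 For a curve $\rho$ in $\mathcal{P}_+(G)$ the energy is $\mathcal{E}(\rho)=\int_0^1\frac12\dot\rho^{\mathsf T}L(\rho)^\dagger\dot\rho\,dt$, and for smooth $h:[0,1]\to\mathbb{R}^n$ with $\sum_ih_i(t)=0$, $h(0)=h(1)=0$, the second variation is $\delta^2\mathcal{E}(\rho)(h)=\frac{d^2}{d\epsilon^2}\big|_{\epsilon=0}\mathcal{E}(\rho+\epsilon h)$. The Jacobi equation along the geodesic $\rho$, for fields $h$ vanishing at both endpoints, is the Euler-Lagrange equation (in $h$) of the quadratic functional $h\mapsto\delta^2\mathcal{E}(\rho)(h)$; it is the variational formulation of $\nabla^W_{\dot\rho}\nabla^W_{\dot\rho}h+R^W(h,\dot\rho)\dot\rho=0$, where $\nabla^W$ and $R^W$ are the Levi-Civita connection and curvature tensor of $g_W$. *)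

theory Defs
  imports "HOL-Analysis.Analysis"
begin

section \<open>Weighted graphs and the weighted Laplacian\<close>

text \<open>The vertex set is the finite type \<open>'n\<close>, and \<open>\<real>\<^sup>n\<close> is \<^typ>\<open>real ^ 'n\<close>.\<close>

definition weighted_graph :: "('n::finite \<times> 'n) set \<Rightarrow> ('n \<Rightarrow> 'n \<Rightarrow> real) \<Rightarrow> bool" where
  "weighted_graph E \<omega> \<longleftrightarrow> sym E \<and>
     (\<forall>i j. \<omega> i j = \<omega> j i \<and> ((i, j) \<in> E \<longrightarrow> \<omega> i j > 0) \<and> ((i, j) \<notin> E \<longrightarrow> \<omega> i j = 0))"

definition connected_graph :: "('n::finite \<times> 'n) set \<Rightarrow> bool" where
  "connected_graph E \<longleftrightarrow> (\<forall>i j. (i, j) \<in> E\<^sup>*)"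

definition theta :: "real ^ 'n \<Rightarrow> 'n::finite \<Rightarrow> 'n \<Rightarrow> real" where
  "theta a i j = (a $ i + a $ j) / 2"

definition laplacian ::
  "('n::finite \<times> 'n) set \<Rightarrow> ('n \<Rightarrow> 'n \<Rightarrow> real) \<Rightarrow> real ^ 'n \<Rightarrow> real ^ 'n ^ 'n" where
  "laplacian E \<omega> a =
     matrix (\<lambda>\<Phi>. \<chi> i. \<Sum>j\<in>{j. (i, j) \<in> E}. \<omega> i j * theta a i j * (\<Phi> $ i - \<Phi> $ j))"

definition is_pinv :: "real ^ 'n::finite ^ 'm::finite \<Rightarrow> real ^ 'm ^ 'n \<Rightarrow> bool" where
  "is_pinv A X \<longleftrightarrow> A ** X ** A = A \<and> X ** A ** X = X \<and>
     transpose (A ** X) = A ** X \<and> transpose (X ** A) = X ** A"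

definition pinv :: "real ^ 'n::finite ^ 'm::finite \<Rightarrow> real ^ 'm ^ 'n" where
  "pinv A = (THE X. is_pinv A X)"

section \<open>The probability simplex and its metric\<close>

definition simplex_pos :: "(real ^ 'n::finite) set" where
  "simplex_pos = {\<rho>. (\<Sum>i\<in>UNIV. \<rho> $ i) = 1 \<and> (\<forall>i. \<rho> $ i > 0)}"

text \<open>The tangent space is the same at every point of the simplex.\<close>

definition tangent_space :: "(real ^ 'n::finite) set" where
  "tangent_space = {\<sigma>. (\<Sum>i\<in>UNIV. \<sigma> $ i) = 0}"

definition metric_W ::
  "('n::finite \<times> 'n) set \<Rightarrow> ('n \<Rightarrow> 'n \<Rightarrow> real) \<Rightarrow> real ^ 'n \<Rightarrow> real ^ 'n \<Rightarrow> real ^ 'n \<Rightarrow> real" where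
  "metric_W E \<omega> \<rho> \<sigma>1 \<sigma>2 = \<sigma>1 \<bullet> (pinv (laplacian E \<omega> \<rho>) *v \<sigma>2)"

section \<open>Curves on the unit interval\<close>

text \<open>Derivatives at the endpoints 0 and 1 are one-sided; values outside the interval are irrelevant.\<close>

definition velocity :: "(real \<Rightarrow> real ^ 'n::finite) \<Rightarrow> real \<Rightarrow> real ^ 'n" where
  "velocity c t = vector_derivative c (at t within {0..1})"

definition smooth_curve :: "(real \<Rightarrow> real ^ 'n::finite) \<Rightarrow> bool" where
  "smooth_curve c \<longleftrightarrow> (\<exists>D :: nat \<Rightarrow> real \<Rightarrow> real ^ 'n. D 0 = c \<and>
     (\<forall>k. \<forall>t\<in>{0..1}. (D k has_vector_derivative D (Suc k) t) (at t within {0..1})))"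

definition admissible_variation :: "(real \<Rightarrow> real ^ 'n::finite) \<Rightarrow> bool" where
  "admissible_variation h \<longleftrightarrow>
     smooth_curve h \<and> (\<forall>t\<in>{0..1}. h t \<in> tangent_space) \<and> h 0 = 0 \<and> h 1 = 0"

section \<open>Euler--Lagrange equations\<close>

text \<open>
  A Lagrangian \<open>F t x v\<close> depends on time, position and velocity.  The Euler--Lagrange equation
  \<open>d/dt (\<partial>F/\<partial>v) = \<partial>F/\<partial>x\<close> is paired with tangent vectors \<open>\<sigma>\<close>,
  because all competing curves have a prescribed coordinate sum.
\<close>

definition euler_lagrange ::
  "(real \<Rightarrow> real ^ 'n::finite \<Rightarrow> real ^ 'n \<Rightarrow> real) \<Rightarrow> (real \<Rightarrow> real ^ 'n) \<Rightarrow> bool" where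
  "euler_lagrange F c \<longleftrightarrow> (\<forall>t\<in>{0..1}. \<forall>\<sigma>\<in>tangent_space.
     ((\<lambda>s. deriv (\<lambda>\<epsilon>. F s (c s) (velocity c s + \<epsilon> *\<^sub>R \<sigma>)) 0)
        has_real_derivative deriv (\<lambda>\<epsilon>. F t (c t + \<epsilon> *\<^sub>R \<sigma>) (velocity c t)) 0)
       (at t within {0..1}))"

text \<open>\<open>F\<close> is a Lagrangian of the functional \<open>J\<close> on admissible variations.\<close>

definition is_lagrangian_of ::
  "(real \<Rightarrow> real ^ 'n::finite \<Rightarrow> real ^ 'n \<Rightarrow> real) \<Rightarrow> ((real \<Rightarrow> real ^ 'n) \<Rightarrow> real) \<Rightarrow> bool" where
  "is_lagrangian_of F J \<longleftrightarrow> (\<forall>k. admissible_variation k \<longrightarrow>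
     ((\<lambda>t. F t (k t) (velocity k t)) has_integral J k) {0..1})"

section \<open>Energy, geodesics and the Jacobi equation\<close>

definition energy_density ::
  "('n::finite \<times> 'n) set \<Rightarrow> ('n \<Rightarrow> 'n \<Rightarrow> real) \<Rightarrow> real ^ 'n \<Rightarrow> real ^ 'n \<Rightarrow> real" where
  "energy_density E \<omega> x v = 1 / 2 * metric_W E \<omega> x v v"

definition energy ::
  "('n::finite \<times> 'n) set \<Rightarrow> ('n \<Rightarrow> 'n \<Rightarrow> real) \<Rightarrow> (real \<Rightarrow> real ^ 'n) \<Rightarrow> real" where
  "energy E \<omega> \<rho> = integral {0..1} (\<lambda>t. energy_density E \<omega> (\<rho> t) (velocity \<rho> t))"

text \<open>
  A geodesic is a smooth solution of the Euler--Lagrange equation of the energy.  In the affine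
  chart, \<open>d/dt g(\<rho>', \<sigma>) = 1/2 (D\<^sub>\<sigma> g)(\<rho>', \<rho>')\<close> for all tangent \<open>\<sigma>\<close>
  is the vanishing of the Levi-Civita covariant derivative of \<open>\<rho>'\<close> along \<open>\<rho>\<close>.
\<close>

definition geodesic_W ::
  "('n::finite \<times> 'n) set \<Rightarrow> ('n \<Rightarrow> 'n \<Rightarrow> real) \<Rightarrow> (real \<Rightarrow> real ^ 'n) \<Rightarrow> bool" where
  "geodesic_W E \<omega> \<rho> \<longleftrightarrow> smooth_curve \<rho> \<and> (\<forall>t\<in>{0..1}. \<rho> t \<in> simplex_pos) \<and>
     euler_lagrange (\<lambda>t x v. energy_density E \<omega> x v) \<rho>"

definition second_variation ::
  "('n::finite \<times> 'n) set \<Rightarrow> ('n \<Rightarrow> 'n \<Rightarrow> real) \<Rightarrow> (real \<Rightarrow> real ^ 'n) \<Rightarrow>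
   (real \<Rightarrow> real ^ 'n) \<Rightarrow> real" where
  "second_variation E \<omega> \<rho> h = (deriv ^^ 2) (\<lambda>\<epsilon>. energy E \<omega> (\<lambda>t. \<rho> t + \<epsilon> *\<^sub>R h t)) 0"

definition second_variation_density ::
  "('n::finite \<times> 'n) set \<Rightarrow> ('n \<Rightarrow> 'n \<Rightarrow> real) \<Rightarrow> (real \<Rightarrow> real ^ 'n) \<Rightarrow>
   real \<Rightarrow> real ^ 'n \<Rightarrow> real ^ 'n \<Rightarrow> real" where
  "second_variation_density E \<omega> \<rho> t x v =
     (deriv ^^ 2) (\<lambda>\<epsilon>. energy_density E \<omega> (\<rho> t + \<epsilon> *\<^sub>R x) (velocity \<rho> t + \<epsilon> *\<^sub>R v)) 0"

text \<open>
  The Jacobi equation is the Euler--Lagrange equation, in \<open>h\<close>, of the second variation.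
  The first conjunct does not depend on \<open>h\<close>; it is there so that the differential
  equation is the one belonging to the functional \<^const>\<open>second_variation\<close> itself, not merely
  to a density defined separately.
\<close>

definition jacobi_equation ::
  "('n::finite \<times> 'n) set \<Rightarrow> ('n \<Rightarrow> 'n \<Rightarrow> real) \<Rightarrow> (real \<Rightarrow> real ^ 'n) \<Rightarrow>
   (real \<Rightarrow> real ^ 'n) \<Rightarrow> bool" where
  "jacobi_equation E \<omega> \<rho> h \<longleftrightarrow>
     is_lagrangian_of (second_variation_density E \<omega> \<rho>) (second_variation E \<omega> \<rho>) \<and>
     euler_lagrange (second_variation_density E \<omega> \<rho>) h"

end

theory Submission
  imports Defs
begin

text \<open>
  The weights \<open>\<theta>\<^sub>i\<^sub>j(a) = (a\<^sub>i + a\<^sub>j)/2\<close> are linear in \<open>a\<close>, so \<open>L(a)\<close> is linear in \<open>a\<close>.  This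
  makes the second variation of the energy a perfect square.  Put \<open>\<Phi> = L(\<rho>)\<^sup>\<dagger> \<rho>'\<close>, the potential
  that drives the curve.  Differentiating \<open>L(\<rho> + \<epsilon> x) \<Phi>\<^sub>\<epsilon> = \<rho>' + \<epsilon> w\<close> in \<open>\<epsilon>\<close> gives
  \<open>d\<Phi>\<^sub>\<epsilon>/d\<epsilon> = L(\<rho>)\<^sup>\<dagger> (w - L(x) \<Phi>)\<close> at \<open>\<epsilon> = 0\<close>, and no term \<open>L''\<close> occurs at second order, so the density
  of the second variation at position \<open>x\<close> and velocity \<open>w\<close> is
  \<open>d \<bullet> L(\<rho>)\<^sup>\<dagger> d\<close> with \<open>d = w - L(x) \<Phi>\<close> (lemma \<open>energy_line_derivatives\<close>).
  The claimed equation says precisely that the defect \<open>d\<close> of \<open>h\<close> vanishes.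

  The Euler--Lagrange equation of this density is, with \<open>\<Psi> = L(\<rho>)\<^sup>\<dagger> d\<close>,
  \<open>d/dt (\<sigma> \<bullet> \<Psi>) = - (L(\<sigma>) \<Phi>) \<bullet> \<Psi>\<close> for all tangent \<open>\<sigma>\<close>
  (lemma \<open>euler_lagrange_second_variation\<close>).  A vanishing defect gives \<open>\<Psi> = 0\<close>, which solves
  it.  Conversely, a solution \<open>h\<close> satisfies
  \<open>d/dt (h \<bullet> \<Psi>) = h' \<bullet> \<Psi> - (L(h) \<Phi>) \<bullet> \<Psi> = d \<bullet> \<Psi> = \<Psi> \<bullet> L(\<rho>) \<Psi> \<ge> 0\<close>.
  So \<open>h \<bullet> \<Psi>\<close> is nondecreasing, and it vanishes at both ends because \<open>h\<close> does; hence it is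
  constant, \<open>\<Psi> \<bullet> L(\<rho>) \<Psi> = 0\<close> throughout, and connectedness of the graph forces \<open>\<Psi> = 0\<close>, that is
  \<open>d = 0\<close>.

  The remaining point is that the density really integrates to the second variation.  This is
  differentiation under the integral sign, twice, and rests on the continuity of
  \<open>(a, \<sigma>) \<mapsto> L(a)\<^sup>\<dagger> \<sigma>\<close> (lemma \<open>tendsto_potential\<close>) and on the perturbed curve staying in the
  positive orthant uniformly in time (lemma \<open>perturbation_stays_positive\<close>).
\<close>

section \<open>Analytic and matrix preliminaries\<close>

text \<open>An exact difference quotient that is continuous at the base point yields the derivative with no
  error estimate; the resolvent identity for \<open>L(a)\<close> provides such a quotient.\<close>

lemma has_vector_derivative_caratheodory:
  fixes f :: "real \<Rightarrow> 'a::real_normed_vector"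
  assumes eq: "\<forall>\<^sub>F y in at x. f y - f x = (y - x) *\<^sub>R q y" and cont: "isCont q x"
  shows "(f has_vector_derivative q x) (at x)"
proof -
  have "((\<lambda>y. norm (q y - q x)) \<longlongrightarrow> norm (q x - q x)) (at x)"
    using cont unfolding isCont_def by (intro tendsto_intros)
  then have lim: "((\<lambda>y. norm (q y - q x)) \<longlongrightarrow> 0) (at x)" by simp
  have "\<forall>\<^sub>F y in at x. norm (q y - q x) = norm (f y - f x - (y - x) *\<^sub>R q x) / norm (y - x)"
    using eq eventually_neq_at_within[of x x UNIV]
  proof eventually_elim
    case (elim y)
    then have "f y - f x - (y - x) *\<^sub>R q x = (y - x) *\<^sub>R (q y - q x)"
      by (simp add: scaleR_diff_right)
    then show ?case using elim by simp
  qed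
  from Lim_transform_eventually[OF lim this] show ?thesis
    unfolding has_vector_derivative_def has_derivative_iff_norm
    by (simp add: bounded_linear_scaleR_left)
qed

lemma tendsto_det:
  fixes A :: "'a \<Rightarrow> real ^ 'n::finite ^ 'n"
  assumes "\<And>i j. ((\<lambda>x. A x $ i $ j) \<longlongrightarrow> B $ i $ j) F"
  shows "((\<lambda>x. det (A x)) \<longlongrightarrow> det B) F"
  unfolding det_def by (intro tendsto_intros assms)

text \<open>Both \<open>A X\<close> and \<open>A Y\<close> are the orthogonal projection onto the range of \<open>A\<close>, and
  \<open>X A\<close> and \<open>Y A\<close> are the one along its kernel; hence \<open>X = X A X = X A Y = Y A Y = Y\<close>.\<close>

lemma is_pinv_unique:
  assumes X: "is_pinv A X" and Y: "is_pinv A Y"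
  shows "X = Y"
proof -
  have XX: "A ** X ** A = A" "X ** A ** X = X" "transpose (A ** X) = A ** X" "transpose (X ** A) = X ** A"
    and YY: "A ** Y ** A = A" "Y ** A ** Y = Y" "transpose (A ** Y) = A ** Y" "transpose (Y ** A) = Y ** A"
    using X Y unfolding is_pinv_def by auto
  have "A ** X = transpose (A ** Y ** A ** X)" using XX YY by simp
  also have "\<dots> = transpose (A ** X) ** transpose (A ** Y)"
    by (simp add: matrix_transpose_mul matrix_mul_assoc)
  also have "\<dots> = A ** X ** A ** Y" using XX YY by (simp add: matrix_mul_assoc)
  finally have 1: "A ** X = A ** Y" using XX by simp
  have "X ** A = transpose (X ** A ** Y ** A)"
    using XX YY by (metis matrix_mul_assoc)
  also have "\<dots> = transpose ((X ** A) ** (Y ** A))" by (simp add: matrix_mul_assoc)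
  also have "\<dots> = (Y ** A) ** (X ** A)" using XX YY by (simp add: matrix_transpose_mul)
  also have "\<dots> = Y ** A" using XX by (metis matrix_mul_assoc)
  finally have 2: "X ** A = Y ** A" .
  show ?thesis using 1 2 XX(2) YY(2) by (metis matrix_mul_assoc)
qed

lemma pinv_eqI: "is_pinv A X \<Longrightarrow> pinv A = X"
  unfolding pinv_def by (blast intro: is_pinv_unique)

definition positive_orthant :: "(real ^ 'n::finite) set" where
  "positive_orthant = {a. \<forall>i. a $ i > 0}"

lemma matrix_mult_distribs:
  fixes A B C :: "real ^ 'n::finite ^ 'n"
  shows "(A + B) ** C = A ** C + B ** C" "C ** (A + B) = C ** A + C ** B"
    "(A - B) ** C = A ** C - B ** C" "C ** (A - B) = C ** A - C ** B"
  by (simp_all add: matrix_matrix_mult_def vec_eq_iff algebra_simps sum.distrib sum_subtractf)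

text \<open>The orthogonal projection of \<open>\<real>\<^sup>n\<close> onto the constant vectors, which are the kernel of
  \<open>L(a)\<close> for every positive \<open>a\<close>.\<close>

definition averaging :: "real ^ 'n::finite ^ 'n" where
  "averaging = (\<chi> i j. 1 / real CARD('n))"

lemma averaging_nth: "(averaging *v \<Phi>) $ i = (\<Sum>j\<in>UNIV. \<Phi> $ j) / real CARD('n)"
  for \<Phi> :: "real ^ 'n::finite"
  by (simp add: averaging_def matrix_vector_mult_def sum_divide_distrib)

lemma averaging_idem: "averaging ** averaging = (averaging :: real ^ 'n::finite ^ 'n)"
  by (simp add: averaging_def matrix_matrix_mult_def vec_eq_iff)

lemma averaging_tangent: "\<sigma> \<in> tangent_space \<Longrightarrow> averaging *v \<sigma> = 0"
  by (simp add: vec_eq_iff averaging_nth tangent_space_def)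

lemma subspace_tangent_space: "subspace tangent_space"
  by (auto simp: subspace_def tangent_space_def sum.distrib simp flip: sum_distrib_left)

lemmas tangent_add = subspace_add[OF subspace_tangent_space]
  and tangent_diff = subspace_diff[OF subspace_tangent_space]
  and tangent_scale = subspace_scale[OF subspace_tangent_space]

section \<open>The weighted Laplacian of a connected graph\<close>

locale connected_weighted_graph =
  fixes E :: "('n::finite \<times> 'n) set" and \<omega> :: "'n \<Rightarrow> 'n \<Rightarrow> real"
  assumes weighted: "weighted_graph E \<omega>" and connected: "connected_graph E"
begin

abbreviation L :: "real ^ 'n \<Rightarrow> real ^ 'n ^ 'n" where
  "L \<equiv> laplacian E \<omega>"

lemma weight_sym: "\<omega> i j = \<omega> j i"
  using weighted unfolding weighted_graph_def by blast

lemma weight_nonneg: "\<omega> i j \<ge> 0"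
  using weighted unfolding weighted_graph_def by (metis less_eq_real_def)

lemma L_nth: "(L a *v \<Phi>) $ i = (\<Sum>j\<in>UNIV. \<omega> i j * theta a i j * (\<Phi> $ i - \<Phi> $ j))"
proof -
  have "Vector_Spaces.linear (*s) (*s)
      (\<lambda>\<Phi>::real^'n. \<chi> i. \<Sum>j\<in>{j. (i, j) \<in> E}. \<omega> i j * theta a i j * (\<Phi> $ i - \<Phi> $ j))"
    unfolding Vector_Spaces.linear_iff
    by (auto simp: vec_eq_iff algebra_simps sum.distrib sum_subtractf sum_distrib_left
        intro: vec.vector_space_axioms)
  then have "(L a *v \<Phi>) $ i = (\<Sum>j\<in>{j. (i, j) \<in> E}. \<omega> i j * theta a i j * (\<Phi> $ i - \<Phi> $ j))"
    by (simp add: laplacian_def matrix_works)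
  also have "\<dots> = (\<Sum>j\<in>UNIV. \<omega> i j * theta a i j * (\<Phi> $ i - \<Phi> $ j))"
  proof (rule sum.mono_neutral_left)
    show "\<forall>j\<in>UNIV - {j. (i, j) \<in> E}. \<omega> i j * theta a i j * (\<Phi> $ i - \<Phi> $ j) = 0"
      using weighted unfolding weighted_graph_def by (metis DiffE mem_Collect_eq mult_zero_left)
  qed auto
  finally show ?thesis .
qed

text \<open>The Dirichlet form.  Self-adjointness, positivity, the range and the kernel of \<open>L(a)\<close> are all read
  off from it.\<close>

lemma L_form:
  "\<Psi> \<bullet> (L a *v \<Phi>) =
     (\<Sum>i\<in>UNIV. \<Sum>j\<in>UNIV. \<omega> i j * theta a i j * (\<Psi> $ i - \<Psi> $ j) * (\<Phi> $ i - \<Phi> $ j)) / 2"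
proof -
  let ?S = "\<Sum>i\<in>UNIV. \<Sum>j\<in>UNIV. \<omega> i j * theta a i j * \<Psi> $ i * (\<Phi> $ i - \<Phi> $ j)"
  have "?S = (\<Sum>i\<in>UNIV. \<Sum>j\<in>UNIV. \<omega> j i * theta a j i * \<Psi> $ j * (\<Phi> $ j - \<Phi> $ i))"
    by (rule sum.swap)
  also have "\<dots> = (\<Sum>i\<in>UNIV. \<Sum>j\<in>UNIV. \<omega> i j * theta a i j * \<Psi> $ j * (\<Phi> $ j - \<Phi> $ i))"
    by (simp add: weight_sym theta_def add.commute)
  finally have "2 * ?S = ?S + \<dots>" by simp
  also have "\<dots> = (\<Sum>i\<in>UNIV. \<Sum>j\<in>UNIV.
      \<omega> i j * theta a i j * (\<Psi> $ i - \<Psi> $ j) * (\<Phi> $ i - \<Phi> $ j))"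
    unfolding sum.distrib[symmetric] by (intro sum.cong refl) (simp add: algebra_simps)
  finally have "2 * ?S = \<dots>" .
  moreover have "\<Psi> \<bullet> (L a *v \<Phi>) = ?S"
    by (simp add: inner_vec_def L_nth sum_distrib_left mult.assoc mult.left_commute)
  ultimately show ?thesis by simp
qed

lemma L_selfadjoint: "\<Psi> \<bullet> (L a *v \<Phi>) = (L a *v \<Psi>) \<bullet> \<Phi>"
  by (simp add: L_form inner_commute[of "L a *v \<Psi>"] mult.assoc mult.commute[of "\<Psi> $ _ - \<Psi> $ _"])

lemma L_tangent: "L a *v \<Phi> \<in> tangent_space"
  using L_form[of "\<chi> i. 1" a \<Phi>] by (simp add: tangent_space_def inner_vec_def)

lemma L_add_scale: "L (a + c *\<^sub>R b) *v \<Phi> = L a *v \<Phi> + c *\<^sub>R (L b *v \<Phi>)"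
  by (auto simp: vec_eq_iff L_nth theta_def sum_distrib_left sum.distrib[symmetric] field_simps
      intro!: sum.cong)

lemma L_linear: "linear (\<lambda>a. L a *v \<Phi>)"
  using L_add_scale[of _ 1] L_add_scale[of 0]
  by (intro linearI) (auto simp: vec_eq_iff L_nth theta_def)

lemma L_entry: "L a $ i $ j = (\<Sum>k\<in>UNIV. \<omega> i k * theta a i k * (axis j 1 $ i - axis j 1 $ k))"
  using L_nth[of a "axis j 1" i] by (simp add: matrix_vector_mult_basis column_def)

lemma L_form_term_nonneg:
  assumes "a \<in> positive_orthant"
  shows "0 \<le> \<omega> i j * theta a i j * (\<Phi> $ i - \<Phi> $ j) * (\<Phi> $ i - \<Phi> $ j)"
proof -
  have "theta a i j > 0"
    using assms by (simp add: theta_def positive_orthant_def add_pos_pos)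
  then have "0 \<le> (\<omega> i j * theta a i j) * ((\<Phi> $ i - \<Phi> $ j) * (\<Phi> $ i - \<Phi> $ j))"
    using weight_nonneg[of i j] by (metis less_imp_le mult_nonneg_nonneg zero_le_square)
  then show ?thesis by (simp only: mult.assoc)
qed

lemma L_form_nonneg:
  assumes "a \<in> positive_orthant"
  shows "\<Phi> \<bullet> (L a *v \<Phi>) \<ge> 0"
  unfolding L_form by (intro divide_nonneg_pos sum_nonneg L_form_term_nonneg[OF assms]) simp

text \<open>Every edge contributes a nonnegative term, so all terms vanish; each edge has positive
  conductance, so \<open>\<Phi>\<close> agrees at its two ends, and connectedness spreads this to all vertices.\<close>

lemma L_form_eq_0_imp_const:
  assumes a: "a \<in> positive_orthant" and 0: "\<Phi> \<bullet> (L a *v \<Phi>) = 0"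
  shows "\<Phi> $ i = \<Phi> $ j"
proof -
  note nn = L_form_term_nonneg[OF a]
  have "(\<Sum>j\<in>UNIV. \<omega> i j * theta a i j * (\<Phi> $ i - \<Phi> $ j) * (\<Phi> $ i - \<Phi> $ j)) = 0" for i
    using 0 nn unfolding L_form by (subst (asm) divide_eq_0_iff) (auto simp: sum_nonneg_eq_0_iff sum_nonneg)
  then have z: "\<omega> i j * theta a i j * (\<Phi> $ i - \<Phi> $ j) * (\<Phi> $ i - \<Phi> $ j) = 0" for i j
    using nn by (subst (asm) sum_nonneg_eq_0_iff) auto
  have edge: "\<Phi> $ i = \<Phi> $ j" if "(i, j) \<in> E" for i j
  proof -
    have "\<omega> i j > 0" using that weighted unfolding weighted_graph_def by blast
    moreover have "theta a i j > 0"
      using a by (simp add: theta_def positive_orthant_def add_pos_pos)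
    ultimately show ?thesis using z[of i j] by simp
  qed
  have "(i, j) \<in> E\<^sup>*" using connected unfolding connected_graph_def by blast
  then show ?thesis by (induction rule: rtrancl_induct) (auto dest: edge)
qed

lemma const_tangent_eq_0:
  fixes \<Phi> :: "real ^ 'n"
  assumes "\<And>i j. \<Phi> $ i = \<Phi> $ j" and "\<Phi> \<in> tangent_space"
  shows "\<Phi> = 0"
proof -
  have "\<Phi> $ i = 0" for i
  proof -
    have "(\<Sum>j\<in>UNIV. \<Phi> $ j) = real CARD('n) * \<Phi> $ i"
      by (subst assms(1)[of _ i]) simp
    then show ?thesis using assms(2) by (simp add: tangent_space_def)
  qed
  then show ?thesis by (simp add: vec_eq_iff)
qed

lemma L_definite:
  "a \<in> positive_orthant \<Longrightarrow> \<Phi> \<in> tangent_space \<Longrightarrow> \<Phi> \<bullet> (L a *v \<Phi>) = 0 \<Longrightarrow> \<Phi> = 0"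
  by (blast intro: const_tangent_eq_0 L_form_eq_0_imp_const)

lemma L_averaging: "L a ** averaging = 0" "averaging ** L a = 0"
proof -
  have "(L a ** averaging) *v \<Phi> = 0 *v \<Phi>" for \<Phi>
    by (simp add: matrix_vector_mul_assoc[symmetric] vec_eq_iff L_nth averaging_nth)
  then show "L a ** averaging = 0" unfolding matrix_eq by blast
  have "(averaging ** L a) *v \<Phi> = 0 *v \<Phi>" for \<Phi>
    by (simp add: matrix_vector_mul_assoc[symmetric] averaging_tangent L_tangent)
  then show "averaging ** L a = 0" unfolding matrix_eq by blast
qed

text \<open>Adding the projection onto the kernel turns \<open>L(a)\<close> into an invertible matrix that agrees with it
  on tangent vectors.  Everything about \<open>L(a)\<^sup>\<dagger>\<close> is obtained from this ordinary inverse.\<close>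

lemma invertible_L_plus_averaging:
  assumes a: "a \<in> positive_orthant"
  shows "invertible (L a + averaging)"
proof -
  have "\<Phi> = 0" if 0: "(L a + averaging) *v \<Phi> = 0" for \<Phi>
  proof -
    have "averaging *v (L a *v \<Phi>) + averaging *v (averaging *v \<Phi>) = 0"
      using 0 by (metis matrix_vector_mult_add_rdistrib matrix_vector_right_distrib matrix_vector_mult_0_right)
    then have av: "averaging *v \<Phi> = 0"
      by (simp add: matrix_vector_mul_assoc L_averaging averaging_idem)
    then have "\<Phi> \<in> tangent_space"
      by (simp add: vec_eq_iff averaging_nth tangent_space_def)
    moreover have "L a *v \<Phi> = 0"
      using 0 av by (simp add: matrix_vector_mult_add_rdistrib)
    ultimately show ?thesis using L_definite[OF a] by simp
  qed
  then show ?thesis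
    unfolding invertible_left_inverse matrix_left_invertible_ker by blast
qed

text \<open>The inverse of \<open>L(a) + J\<close>, with \<open>J\<close> the averaging projection, still fixes the constants; the
  pseudo-inverse annihilates them, so \<open>J\<close> is taken off again.\<close>

lemma pinv_L:
  assumes a: "a \<in> positive_orthant"
  defines "X \<equiv> matrix_inv (L a + averaging) - averaging"
  shows "pinv (L a) = X" "L a ** X = mat 1 - averaging" "averaging ** X = 0"
proof -
  let ?J = "averaging :: real ^ 'n ^ 'n" and ?B = "L a + averaging"
  let ?I = "matrix_inv ?B"
  have inv: "?B ** ?I = mat 1" "?I ** ?B = mat 1"
    using someI_ex[OF invertible_L_plus_averaging[OF a, unfolded invertible_def]]
    unfolding matrix_inv_def by auto
  have BJ: "?B ** ?J = ?J" "?J ** ?B = ?J"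
    by (simp_all add: matrix_mult_distribs L_averaging averaging_idem)
  have IJ: "?I ** ?J = ?J" "?J ** ?I = ?J"
    by (metis BJ inv matrix_mul_assoc matrix_mul_lid matrix_mul_rid)+
  have XJ: "X ** ?J = 0" and JX: "?J ** X = 0"
    by (simp_all add: X_def matrix_mult_distribs IJ averaging_idem)
  have "?B ** X = mat 1 - ?J" "X ** ?B = mat 1 - ?J"
    unfolding X_def matrix_mult_distribs(3,4) by (simp_all only: inv IJ BJ)
  then have AX: "L a ** X = mat 1 - ?J" and XA: "X ** L a = mat 1 - ?J"
    by (simp_all add: matrix_mult_distribs XJ JX)
  then show "L a ** X = mat 1 - ?J" by simp
  have "is_pinv (L a) X"
    unfolding is_pinv_def AX XA
    by (simp add: matrix_mult_distribs L_averaging JX)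
       (simp add: transpose_def mat_def averaging_def vec_eq_iff)
  then show "pinv (L a) = X" by (rule pinv_eqI)
  show "?J ** X = 0" by (rule JX)
qed

definition potential :: "real ^ 'n \<Rightarrow> real ^ 'n \<Rightarrow> real ^ 'n" where
  "potential a \<sigma> = pinv (L a) *v \<sigma>"

lemma L_potential:
  assumes "a \<in> positive_orthant" "\<sigma> \<in> tangent_space"
  shows "L a *v potential a \<sigma> = \<sigma>"
  unfolding potential_def matrix_vector_mul_assoc pinv_L(1)[OF assms(1)] pinv_L(2)[OF assms(1)]
  using assms by (simp add: matrix_vector_mult_diff_rdistrib averaging_tangent)

lemma potential_tangent:
  assumes "a \<in> positive_orthant"
  shows "potential a \<sigma> \<in> tangent_space"
proof -
  have "averaging *v potential a \<sigma> = 0"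
    using assms by (simp add: potential_def pinv_L matrix_vector_mul_assoc)
  then show ?thesis by (simp add: vec_eq_iff averaging_nth tangent_space_def)
qed

lemma potential_unique:
  assumes a: "a \<in> positive_orthant" and \<Phi>: "\<Phi> \<in> tangent_space"
  shows "potential a (L a *v \<Phi>) = \<Phi>"
proof -
  let ?d = "potential a (L a *v \<Phi>) - \<Phi>"
  have "L a *v ?d = 0"
    using L_potential[OF a L_tangent] by (simp add: matrix_vector_mult_diff_distrib)
  then have "?d = 0"
    using L_definite[OF a, of ?d] potential_tangent[OF a] \<Phi> by (simp add: tangent_diff)
  then show ?thesis by simp
qed

lemma potential_linear: "linear (potential a)"
  unfolding potential_def by (rule matrix_vector_mul_linear)

lemma potential_selfadjoint:
  assumes "a \<in> positive_orthant" "\<sigma> \<in> tangent_space" "\<tau> \<in> tangent_space"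
  shows "\<sigma> \<bullet> potential a \<tau> = \<tau> \<bullet> potential a \<sigma>"
  using L_selfadjoint[of "potential a \<sigma>" a "potential a \<tau>"] assms
  by (simp add: L_potential inner_commute)

text \<open>A formula for the potential as a quotient of determinants, from which its continuity is evident.\<close>

lemma potential_cramer:
  assumes a: "a \<in> positive_orthant" and \<sigma>: "\<sigma> \<in> tangent_space"
  shows "potential a \<sigma> = (\<chi> k. det (\<chi> i j. if j = k then \<sigma> $ i else (L a + averaging) $ i $ j)
            / det (L a + averaging))"
proof -
  have "(L a + averaging) *v potential a \<sigma> = \<sigma>"
    using assms by (simp add: matrix_vector_mult_add_rdistrib L_potential averaging_tangent potential_tangent)
  moreover have "det (L a + averaging) \<noteq> 0"
    using invertible_L_plus_averaging[OF a] by (simp add: invertible_det_nz)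
  ultimately show ?thesis by (simp add: cramer)
qed

lemma tendsto_L:
  assumes "(a \<longlongrightarrow> a0) F" "(\<Phi> \<longlongrightarrow> \<Phi>0) F"
  shows "((\<lambda>x. L (a x) *v \<Phi> x) \<longlongrightarrow> L a0 *v \<Phi>0) F"
  by (rule vec_tendstoI) (auto simp: L_nth theta_def intro!: tendsto_intros assms)

lemma tendsto_potential:
  assumes a: "(a \<longlongrightarrow> a0) F" and \<sigma>: "(\<sigma> \<longlongrightarrow> \<sigma>0) F"
    and a0: "a0 \<in> positive_orthant" and \<sigma>0: "\<sigma>0 \<in> tangent_space"
    and ev: "\<forall>\<^sub>F x in F. a x \<in> positive_orthant \<and> \<sigma> x \<in> tangent_space"
  shows "((\<lambda>x. potential (a x) (\<sigma> x)) \<longlongrightarrow> potential a0 \<sigma>0) F"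
proof -
  let ?c = "\<lambda>a \<sigma>. \<chi> k. det (\<chi> i j. if j = k then \<sigma> $ i else (L a + averaging) $ i $ j)
            / det (L a + averaging)"
  have entry: "((\<lambda>x. (L (a x) + averaging) $ i $ j) \<longlongrightarrow> (L a0 + averaging) $ i $ j) F" for i j
    by (simp add: L_entry theta_def) (intro tendsto_intros a; simp)
  have "((\<lambda>x. ?c (a x) (\<sigma> x)) \<longlongrightarrow> ?c a0 \<sigma>0) F"
  proof (rule vec_tendstoI, simp only: vec_lambda_beta, rule tendsto_divide)
    show "((\<lambda>x. det (L (a x) + averaging)) \<longlongrightarrow> det (L a0 + averaging)) F"
      by (rule tendsto_det[OF entry])
    show "det (L a0 + averaging) \<noteq> 0"
      using invertible_L_plus_averaging[OF a0] by (simp add: invertible_det_nz)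
    show "((\<lambda>x. det (\<chi> i j. if j = k then \<sigma> x $ i else (L (a x) + averaging) $ i $ j))
        \<longlongrightarrow> det (\<chi> i j. if j = k then \<sigma>0 $ i else (L a0 + averaging) $ i $ j)) F" for k
    proof (rule tendsto_det)
      fix i j
      show "((\<lambda>x. (\<chi> i j. if j = k then \<sigma> x $ i else (L (a x) + averaging) $ i $ j) $ i $ j)
        \<longlongrightarrow> (\<chi> i j. if j = k then \<sigma>0 $ i else (L a0 + averaging) $ i $ j) $ i $ j) F"
        using entry[of i j] tendsto_vec_nth[OF \<sigma>, of i] by auto
    qed
  qed
  then have "((\<lambda>x. ?c (a x) (\<sigma> x)) \<longlongrightarrow> potential a0 \<sigma>0) F"
    by (simp only: potential_cramer[OF a0 \<sigma>0])
  moreover have "\<forall>\<^sub>F x in F. ?c (a x) (\<sigma> x) = potential (a x) (\<sigma> x)"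
    using ev by eventually_elim (simp only: potential_cramer)
  ultimately show ?thesis by (rule Lim_transform_eventually)
qed

end

section \<open>The energy along a line is twice differentiable\<close>

lemma second_deriv_eqI:
  fixes f g :: "real \<Rightarrow> real"
  assumes S: "open S" "x \<in> S"
    and f: "\<And>y. y \<in> S \<Longrightarrow> (f has_real_derivative g y) (at y)"
    and g: "(g has_real_derivative D) (at x)"
  shows "(deriv ^^ 2) f x = D"
proof -
  have "\<forall>\<^sub>F y in nhds x. deriv f y = g y"
    using eventually_nhds_in_open[OF S] by eventually_elim (rule DERIV_imp_deriv[OF f])
  then have "deriv (deriv f) x = deriv g x" by (rule deriv_cong_ev) simp
  then show ?thesis using DERIV_imp_deriv[OF g] by (simp add: numeral_2_eq_2)
qed

lemma open_positive_orthant: "open (positive_orthant :: (real ^ 'n::finite) set)"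
proof -
  have "positive_orthant = (\<Inter>i. {a :: real ^ 'n. 0 < a $ i})"
    by (auto simp: positive_orthant_def)
  moreover have "open (\<Inter>i. {a :: real ^ 'n. 0 < a $ i})"
    by (intro open_INT ballI open_Collect_less continuous_intros) auto
  ultimately show ?thesis by simp
qed

context connected_weighted_graph
begin

lemma continuous_on_L:
  assumes "continuous_on S a" "continuous_on S \<Phi>"
  shows "continuous_on S (\<lambda>x. L (a x) *v \<Phi> x)"
  using assms unfolding continuous_on_def by (blast intro: tendsto_L)

lemma continuous_on_potential:
  assumes "continuous_on S a" "continuous_on S \<sigma>"
    and "\<And>x. x \<in> S \<Longrightarrow> a x \<in> positive_orthant" "\<And>x. x \<in> S \<Longrightarrow> \<sigma> x \<in> tangent_space"
  shows "continuous_on S (\<lambda>x. potential (a x) (\<sigma> x))"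
  using assms unfolding continuous_on_def
  by (intro ballI tendsto_potential) (auto simp: eventually_at_filter)

text \<open>The amount by which the velocity \<open>w\<close> of a variation at position \<open>x\<close> fails to satisfy the
  linearised continuity equation \<open>w = L(x) \<Phi>\<close> with the potential \<open>\<Phi>\<close> of the base curve kept fixed.\<close>

definition defect :: "real ^ 'n \<Rightarrow> real ^ 'n \<Rightarrow> real ^ 'n \<Rightarrow> real ^ 'n \<Rightarrow> real ^ 'n" where
  "defect a v x w = w - L x *v potential a v"

lemma defect_tangent: "w \<in> tangent_space \<Longrightarrow> defect a v x w \<in> tangent_space"
  unfolding defect_def by (intro tangent_diff L_tangent)

text \<open>Since \<open>L\<close> is linear, the difference of the potentials at two parameters solves an equation with
  the Laplacian at the base parameter: \<open>L(b) (P\<^sub>\<eta> - P\<^sub>\<epsilon>) = (\<eta> - \<epsilon>) (w - L(x) P\<^sub>\<eta>)\<close>.  This is an exact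
  difference quotient, and its limit is found from continuity alone.\<close>

lemma potential_line_derivative:
  fixes a x v w :: "real ^ 'n" and \<epsilon> :: real
  defines "P \<equiv> \<lambda>\<epsilon>. potential (a + \<epsilon> *\<^sub>R x) (v + \<epsilon> *\<^sub>R w)"
  assumes pos: "a + \<epsilon> *\<^sub>R x \<in> positive_orthant" and v: "v \<in> tangent_space" and w: "w \<in> tangent_space"
  shows "(P has_vector_derivative potential (a + \<epsilon> *\<^sub>R x) (defect (a + \<epsilon> *\<^sub>R x) (v + \<epsilon> *\<^sub>R w) x w)) (at \<epsilon>)"
proof -
  define b where "b = a + \<epsilon> *\<^sub>R x"
  define q where "q = (\<lambda>\<eta>. potential b (w - L x *v P \<eta>))"
  have b: "b \<in> positive_orthant" using pos by (simp add: b_def)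
  have vw: "v + \<eta> *\<^sub>R w \<in> tangent_space" for \<eta>
    using v w by (intro tangent_add tangent_scale)
  have lim: "((\<lambda>\<eta>. a + \<eta> *\<^sub>R x) \<longlongrightarrow> a + \<epsilon> *\<^sub>R x) (at \<epsilon>)"
    by (intro tendsto_intros)
  have ev: "\<forall>\<^sub>F \<eta> in at \<epsilon>. a + \<eta> *\<^sub>R x \<in> positive_orthant"
    by (rule topological_tendstoD[OF lim open_positive_orthant pos])
  \<comment> \<open>the resolvent identity, valid for those \<open>\<eta>\<close> at which \<open>a + \<eta> x\<close> is still positive\<close>
  have quotient: "\<forall>\<^sub>F \<eta> in at \<epsilon>. P \<eta> - P \<epsilon> = (\<eta> - \<epsilon>) *\<^sub>R q \<eta>"
    using ev
  proof eventually_elim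
    case (elim \<eta>)
    have "a + \<eta> *\<^sub>R x = b + (\<eta> - \<epsilon>) *\<^sub>R x" by (simp add: b_def algebra_simps)
    then have "L b *v P \<eta> + (\<eta> - \<epsilon>) *\<^sub>R (L x *v P \<eta>) = L (a + \<eta> *\<^sub>R x) *v P \<eta>"
      by (simp add: L_add_scale)
    also have "\<dots> = v + \<eta> *\<^sub>R w"
      unfolding P_def by (rule L_potential[OF elim vw])
    finally have 1: "L b *v P \<eta> = v + \<eta> *\<^sub>R w - (\<eta> - \<epsilon>) *\<^sub>R (L x *v P \<eta>)"
      by (simp add: eq_diff_eq)
    have 2: "L b *v P \<epsilon> = v + \<epsilon> *\<^sub>R w"
      unfolding P_def b_def by (rule L_potential[OF pos vw])
    have "L b *v (P \<eta> - P \<epsilon>) = (\<eta> - \<epsilon>) *\<^sub>R (w - L x *v P \<eta>)"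
      unfolding matrix_vector_mult_diff_distrib 1 2 by (simp add: algebra_simps)
    moreover have "P \<eta> - P \<epsilon> \<in> tangent_space"
      using potential_tangent[OF elim] potential_tangent[OF pos] unfolding P_def by (intro tangent_diff)
    ultimately have "P \<eta> - P \<epsilon> = potential b ((\<eta> - \<epsilon>) *\<^sub>R (w - L x *v P \<eta>))"
      using potential_unique[OF b] by metis
    then show ?case by (simp add: q_def linear_scale[OF potential_linear])
  qed
  have P: "(P \<longlongrightarrow> P \<epsilon>) (at \<epsilon>)"
    unfolding P_def using ev pos vw
    by (intro tendsto_potential) (auto intro!: tendsto_intros)
  have "isCont q \<epsilon>"
    unfolding isCont_def q_def using b w
    by (intro tendsto_potential tendsto_intros tendsto_L P tangent_diff L_tangent always_eventually allI conjI)
  from has_vector_derivative_caratheodory[OF quotient this]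
  show ?thesis by (simp add: q_def defect_def b_def P_def)
qed

lemma energy_density_eq: "energy_density E \<omega> a v = 1 / 2 * (v \<bullet> potential a v)"
  by (simp add: energy_density_def metric_W_def potential_def)

text \<open>The first derivative of the energy density in the direction \<open>(x, w)\<close>: the Hamiltonian of the
  metric is \<open>1/2 \<Phi> \<bullet> L(a) \<Phi>\<close>, and its derivative in the position enters with a minus sign.\<close>

definition energy_slope :: "real ^ 'n \<Rightarrow> real ^ 'n \<Rightarrow> real ^ 'n \<Rightarrow> real ^ 'n \<Rightarrow> real" where
  "energy_slope a v x w =
     w \<bullet> potential a v - 1 / 2 * (potential a v \<bullet> (L x *v potential a v))"

text \<open>The integrand of the index form: the density of the second variation.\<close>

definition index_density :: "real ^ 'n \<Rightarrow> real ^ 'n \<Rightarrow> real ^ 'n \<Rightarrow> real ^ 'n \<Rightarrow> real" where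
  "index_density a v x w = defect a v x w \<bullet> potential a (defect a v x w)"

text \<open>Both formulas follow from the product rule and the derivative of the potential.  The terms with
  \<open>P'\<close> are moved to the other side by self-adjointness of \<open>L(a)\<^sup>\<dagger>\<close> in the first and of \<open>L(x)\<close> in the
  second; linearity of \<open>L\<close> means that \<open>L(x)\<close> itself has no derivative in \<open>\<epsilon>\<close>.\<close>

lemma energy_line_derivatives:
  fixes a x v w :: "real ^ 'n" and \<epsilon> :: real
  assumes pos: "a + \<epsilon> *\<^sub>R x \<in> positive_orthant" and v: "v \<in> tangent_space" and w: "w \<in> tangent_space"
  shows "((\<lambda>\<epsilon>. energy_density E \<omega> (a + \<epsilon> *\<^sub>R x) (v + \<epsilon> *\<^sub>R w)) has_real_derivative
            energy_slope (a + \<epsilon> *\<^sub>R x) (v + \<epsilon> *\<^sub>R w) x w) (at \<epsilon>)" (is ?first)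
    and "((\<lambda>\<epsilon>. energy_slope (a + \<epsilon> *\<^sub>R x) (v + \<epsilon> *\<^sub>R w) x w) has_real_derivative
            index_density (a + \<epsilon> *\<^sub>R x) (v + \<epsilon> *\<^sub>R w) x w) (at \<epsilon>)" (is ?second)
proof -
  define P where "P = (\<lambda>\<epsilon>. potential (a + \<epsilon> *\<^sub>R x) (v + \<epsilon> *\<^sub>R w))"
  define d where "d = defect (a + \<epsilon> *\<^sub>R x) (v + \<epsilon> *\<^sub>R w) x w"
  define P' where "P' = potential (a + \<epsilon> *\<^sub>R x) d"
  have d: "d = w - L x *v P \<epsilon>" by (simp add: d_def defect_def P_def)
  have dT: "d \<in> tangent_space" unfolding d_def using w by (rule defect_tangent)
  have vw: "v + \<epsilon> *\<^sub>R w \<in> tangent_space"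
    using v w by (intro tangent_add tangent_scale)
  have "(P has_vector_derivative P') (at \<epsilon>)"
    unfolding P_def P'_def d_def by (rule potential_line_derivative[OF pos v w])
  then have P: "(P has_derivative (\<lambda>s. s *\<^sub>R P')) (at \<epsilon>)"
    by (simp add: has_vector_derivative_def)
  have LP: "((\<lambda>\<epsilon>. L x *v P \<epsilon>) has_derivative (\<lambda>s. L x *v (s *\<^sub>R P'))) (at \<epsilon>)"
    by (rule bounded_linear.has_derivative[OF matrix_vector_mul_bounded_linear P])
  have sym: "(v + \<epsilon> *\<^sub>R w) \<bullet> P' = d \<bullet> P \<epsilon>"
    unfolding P'_def P_def by (rule potential_selfadjoint[OF pos vw dT])
  have "((\<lambda>\<epsilon>. 1 / 2 * ((v + \<epsilon> *\<^sub>R w) \<bullet> P \<epsilon>)) has_derivative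
      (\<lambda>s. 1 / 2 * ((v + \<epsilon> *\<^sub>R w) \<bullet> (s *\<^sub>R P') + (s *\<^sub>R w) \<bullet> P \<epsilon>))) (at \<epsilon>)"
    by (auto intro!: derivative_eq_intros P)
  moreover have "1 / 2 * ((v + \<epsilon> *\<^sub>R w) \<bullet> (s *\<^sub>R P') + (s *\<^sub>R w) \<bullet> P \<epsilon>)
      = (w \<bullet> P \<epsilon> - 1 / 2 * (P \<epsilon> \<bullet> (L x *v P \<epsilon>))) * s" for s
    by (simp add: sym) (simp add: d inner_diff_left inner_commute[of _ "P \<epsilon>"] algebra_simps)
  ultimately show ?first
    unfolding has_field_derivative_def energy_density_eq energy_slope_def P_def[symmetric]
    by (simp add: P_def)
  have "((\<lambda>\<epsilon>. w \<bullet> P \<epsilon> - 1 / 2 * (P \<epsilon> \<bullet> (L x *v P \<epsilon>))) has_derivative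
      (\<lambda>s. w \<bullet> (s *\<^sub>R P') - 1 / 2 * (P \<epsilon> \<bullet> (L x *v (s *\<^sub>R P')) + (s *\<^sub>R P') \<bullet> (L x *v P \<epsilon>)))) (at \<epsilon>)"
    by (auto intro!: derivative_eq_intros P LP)
  moreover have "w \<bullet> (s *\<^sub>R P') - 1 / 2 * (P \<epsilon> \<bullet> (L x *v (s *\<^sub>R P')) + (s *\<^sub>R P') \<bullet> (L x *v P \<epsilon>))
      = (d \<bullet> P') * s" for s
    unfolding L_selfadjoint[of "P \<epsilon>"]
    by (simp add: d inner_diff_left inner_commute[of P'] algebra_simps)
  ultimately show ?second
    unfolding has_field_derivative_def energy_slope_def index_density_def
    by (simp add: P_def P'_def d_def)
qed

lemma second_deriv_energy_density:
  assumes a: "a \<in> positive_orthant" and v: "v \<in> tangent_space" and w: "w \<in> tangent_space"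
  shows "(deriv ^^ 2) (\<lambda>\<epsilon>. energy_density E \<omega> (a + \<epsilon> *\<^sub>R x) (v + \<epsilon> *\<^sub>R w)) 0
    = index_density a v x w"
proof (rule second_deriv_eqI)
  have "open ((\<lambda>\<epsilon>. a + \<epsilon> *\<^sub>R x) -` positive_orthant)"
    by (intro open_vimage open_positive_orthant continuous_intros)
  then show "open {\<epsilon>. a + \<epsilon> *\<^sub>R x \<in> positive_orthant}" by (simp add: vimage_def)
  show "0 \<in> {\<epsilon>. a + \<epsilon> *\<^sub>R x \<in> positive_orthant}" using a by simp
  show "((\<lambda>\<epsilon>. energy_density E \<omega> (a + \<epsilon> *\<^sub>R x) (v + \<epsilon> *\<^sub>R w)) has_real_derivative
      energy_slope (a + y *\<^sub>R x) (v + y *\<^sub>R w) x w) (at y)"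
    if "y \<in> {\<epsilon>. a + \<epsilon> *\<^sub>R x \<in> positive_orthant}" for y
    using that v w by (intro energy_line_derivatives) auto
  show "((\<lambda>\<epsilon>. energy_slope (a + \<epsilon> *\<^sub>R x) (v + \<epsilon> *\<^sub>R w) x w) has_real_derivative
      index_density a v x w) (at 0)"
    using energy_line_derivatives(2)[of a 0 x v w] a v w by simp
qed

end

section \<open>Smooth curves and their linear perturbations\<close>

lemma smooth_curve_velocity:
  assumes c: "smooth_curve c"
  shows "t \<in> {0..1} \<Longrightarrow> (c has_vector_derivative velocity c t) (at t within {0..1})"
    and "continuous_on {0..1} (velocity c)"
proof -
  obtain D where D: "D 0 = c"
      "\<And>k t. t \<in> {0..1} \<Longrightarrow> (D k has_vector_derivative D (Suc k) t) (at t within {0..1})"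
    using c unfolding smooth_curve_def by blast
  have vel: "velocity c t = D 1 t" if "t \<in> {0..1}" for t
    unfolding velocity_def
    using vector_derivative_within_closed_interval[OF _ that D(2)[OF that, of 0]] D(1) by simp
  show "(c has_vector_derivative velocity c t) (at t within {0..1})" if "t \<in> {0..1}"
    using D(2)[OF that, of 0] vel[OF that] D(1) by simp
  have "continuous_on {0..1} (D 1)"
    using D(2)[of _ 1] by (blast intro: continuous_on_vector_derivative)
  then show "continuous_on {0..1} (velocity c)"
    by (simp only: vel cong: continuous_on_cong)
qed

lemma smooth_curve_continuous: "smooth_curve c \<Longrightarrow> continuous_on {0..1} c"
  using smooth_curve_velocity(1) by (blast intro: continuous_on_vector_derivative)

lemma velocity_tangent:
  fixes c :: "real \<Rightarrow> real ^ 'n::finite"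
  assumes c: "smooth_curve c" and const: "\<And>t. t \<in> {0..1} \<Longrightarrow> (\<Sum>i\<in>UNIV. c t $ i) = m"
    and t: "t \<in> {0..1}"
  shows "velocity c t \<in> tangent_space"
proof -
  have lin: "bounded_linear (\<lambda>x::real^'n. \<Sum>i\<in>UNIV. x $ i)"
    by (intro bounded_linear_sum bounded_linear_vec_nth)
  have "((\<lambda>s. \<Sum>i\<in>UNIV. c s $ i) has_vector_derivative (\<Sum>i\<in>UNIV. velocity c t $ i))
      (at t within {0..1})"
    by (rule bounded_linear.has_vector_derivative[OF lin smooth_curve_velocity(1)[OF c t]])
  moreover have "((\<lambda>s. \<Sum>i\<in>UNIV. c s $ i) has_vector_derivative 0) (at t within {0..1})"
    by (rule has_vector_derivative_transform[OF t _ has_vector_derivative_const[of m]])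
       (simp add: const)
  ultimately have "(\<Sum>i\<in>UNIV. velocity c t $ i) = 0"
    using vector_derivative_unique_within_closed_interval[of 0 1 t] t by auto
  then show ?thesis by (simp add: tangent_space_def)
qed

lemma velocity_line:
  assumes "smooth_curve \<rho>" "smooth_curve k" and t: "t \<in> {0..1}"
  shows "velocity (\<lambda>t. \<rho> t + \<epsilon> *\<^sub>R k t) t = velocity \<rho> t + \<epsilon> *\<^sub>R velocity k t"
proof -
  have "((\<lambda>t. \<rho> t + \<epsilon> *\<^sub>R k t) has_vector_derivative velocity \<rho> t + \<epsilon> *\<^sub>R velocity k t)
      (at t within {0..1})"
    using smooth_curve_velocity(1)[OF assms(1) t] smooth_curve_velocity(1)[OF assms(2) t]
    by (auto intro!: derivative_eq_intros)
  then show ?thesis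
    unfolding velocity_def[of "\<lambda>t. \<rho> t + \<epsilon> *\<^sub>R k t"]
    using vector_derivative_within_closed_interval[of 0 1 t] t by simp
qed

text \<open>The image of the curve is compact in an open set, so it has a neighbourhood of uniform radius there,
  and the perturbation is bounded.  The resulting interval of parameters does not depend on time,
  as differentiation under the integral sign demands.\<close>

lemma perturbation_stays_positive:
  fixes \<rho> k :: "real \<Rightarrow> real ^ 'n::finite"
  assumes \<rho>: "continuous_on {0..1} \<rho>" "\<And>t. t \<in> {0..1} \<Longrightarrow> \<rho> t \<in> positive_orthant"
    and k: "continuous_on {0..1} k"
  obtains \<delta> where "\<delta> > 0"
    "\<And>\<epsilon> t. \<epsilon> \<in> {-\<delta><..<\<delta>} \<Longrightarrow> t \<in> {0..1} \<Longrightarrow> \<rho> t + \<epsilon> *\<^sub>R k t \<in> positive_orthant"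
proof -
  have "compact (\<rho> ` {0..1})" using \<rho>(1) by (intro compact_continuous_image) auto
  then obtain r where r: "r > 0" "(\<Union>x\<in>\<rho> ` {0..1}. ball x r) \<subseteq> positive_orthant"
    using compact_subset_open_imp_ball_epsilon_subset[OF _ open_positive_orthant] \<rho>(2)
    by (metis image_subsetI)
  have "bounded (k ` {0..1})"
    using k by (intro compact_imp_bounded compact_continuous_image) auto
  then obtain K where K: "K > 0" "\<And>t. t \<in> {0..1} \<Longrightarrow> norm (k t) \<le> K"
    unfolding bounded_pos by blast
  show ?thesis
  proof (rule that[of "r / K"])
    show "r / K > 0" using r K by simp
    fix \<epsilon> t :: real assume \<epsilon>: "\<epsilon> \<in> {-(r / K)<..<r / K}" and t: "t \<in> {0..1}"
    have "norm (\<epsilon> *\<^sub>R k t) \<le> \<bar>\<epsilon>\<bar> * K" using K(2)[OF t] by (simp add: mult_left_mono)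
    also have "\<dots> < r" using \<epsilon> K(1) by (auto simp: pos_less_divide_eq[symmetric])
    finally have "\<rho> t + \<epsilon> *\<^sub>R k t \<in> ball (\<rho> t) r" by (simp add: dist_norm)
    then show "\<rho> t + \<epsilon> *\<^sub>R k t \<in> positive_orthant" using r(2) t by blast
  qed
qed

section \<open>The second variation and its Euler--Lagrange equation\<close>

context connected_weighted_graph
begin

lemma second_variation_density_eq:
  assumes "\<rho> t \<in> positive_orthant" "velocity \<rho> t \<in> tangent_space" "w \<in> tangent_space"
  shows "second_variation_density E \<omega> \<rho> t x w = index_density (\<rho> t) (velocity \<rho> t) x w"
  unfolding second_variation_density_def by (rule second_deriv_energy_density) (use assms in auto)

text \<open>The second variation is the integral of its density, by the Leibniz rule applied twice on a
  neighbourhood of \<open>\<epsilon> = 0\<close> on which all perturbed curves remain positive.\<close>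

lemma second_variation_lagrangian:
  assumes \<rho>: "smooth_curve \<rho>" and pos: "\<And>t. t \<in> {0..1} \<Longrightarrow> \<rho> t \<in> positive_orthant"
    and tan: "\<And>t. t \<in> {0..1} \<Longrightarrow> velocity \<rho> t \<in> tangent_space"
  shows "is_lagrangian_of (second_variation_density E \<omega> \<rho>) (second_variation E \<omega> \<rho>)"
  unfolding is_lagrangian_of_def
proof (intro allI impI)
  fix k :: "real \<Rightarrow> real ^ 'n"
  assume "admissible_variation k"
  then have k: "smooth_curve k" and k_tan: "\<And>t. t \<in> {0..1} \<Longrightarrow> (\<Sum>i\<in>UNIV. k t $ i) = 0"
    unfolding admissible_variation_def tangent_space_def by auto
  have tank: "velocity k t \<in> tangent_space" if "t \<in> {0..1}" for t
    using velocity_tangent[OF k k_tan that] by simp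
  obtain \<delta> where \<delta>: "\<delta> > 0"
    "\<And>\<epsilon> t. \<epsilon> \<in> {-\<delta><..<\<delta>} \<Longrightarrow> t \<in> {0..1} \<Longrightarrow> \<rho> t + \<epsilon> *\<^sub>R k t \<in> positive_orthant"
    using perturbation_stays_positive[OF smooth_curve_continuous[OF \<rho>] pos smooth_curve_continuous[OF k]]
    by blast
  define U where "U = {-\<delta><..<\<delta>}"
  define A where "A = (\<lambda>\<epsilon> t. \<rho> t + \<epsilon> *\<^sub>R k t)"
  define V where "V = (\<lambda>\<epsilon> t. velocity \<rho> t + \<epsilon> *\<^sub>R velocity k t)"
  define f0 where "f0 = (\<lambda>\<epsilon> t. energy_density E \<omega> (A \<epsilon> t) (V \<epsilon> t))"
  define f1 where "f1 = (\<lambda>\<epsilon> t. energy_slope (A \<epsilon> t) (V \<epsilon> t) (k t) (velocity k t))"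
  define f2 where "f2 = (\<lambda>\<epsilon> t. index_density (A \<epsilon> t) (V \<epsilon> t) (k t) (velocity k t))"
  have U: "open U" "0 \<in> U" "convex U" using \<delta>(1) by (auto simp: U_def)
  have A: "A \<epsilon> t \<in> positive_orthant" if "\<epsilon> \<in> U" "t \<in> {0..1}" for \<epsilon> t
    using \<delta>(2) that by (simp add: U_def A_def)
  have V: "V \<epsilon> t \<in> tangent_space" if "t \<in> {0..1}" for \<epsilon> t
    unfolding V_def using tan tank that by (intro tangent_add tangent_scale)

  let ?S = "U \<times> {0..1::real}"
  have cont: "continuous_on ?S (\<lambda>z. c (snd z))" if "continuous_on {0..1} c"
      for c :: "real \<Rightarrow> real ^ 'n"
    by (rule continuous_on_compose2[OF that]) (auto intro: continuous_intros)
  note cont_curves = cont[OF smooth_curve_continuous[OF \<rho>]] cont[OF smooth_curve_continuous[OF k]]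
    cont[OF smooth_curve_velocity(2)[OF \<rho>]] cont[OF smooth_curve_velocity(2)[OF k]]
  have cA: "continuous_on ?S (\<lambda>z. A (fst z) (snd z))"
    unfolding A_def by (intro continuous_intros cont_curves)
  have cV: "continuous_on ?S (\<lambda>z. V (fst z) (snd z))"
    unfolding V_def by (intro continuous_intros cont_curves)
  have cP: "continuous_on ?S (\<lambda>z. potential (A (fst z) (snd z)) (V (fst z) (snd z)))"
    by (rule continuous_on_potential[OF cA cV]) (auto intro: A V)
  have cd: "continuous_on ?S (\<lambda>z. defect (A (fst z) (snd z)) (V (fst z) (snd z)) (k (snd z)) (velocity k (snd z)))"
    unfolding defect_def by (intro continuous_intros cont_curves continuous_on_L cP)
  have c0: "continuous_on ?S (\<lambda>z. f0 (fst z) (snd z))"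
    unfolding f0_def energy_density_eq by (intro continuous_intros cV cP)
  have c1: "continuous_on ?S (\<lambda>z. f1 (fst z) (snd z))"
    unfolding f1_def energy_slope_def by (intro continuous_intros cont_curves cP continuous_on_L)
  have c2: "continuous_on ?S (\<lambda>z. f2 (fst z) (snd z))"
    unfolding f2_def index_density_def
    by (intro continuous_intros cd continuous_on_potential cA) (auto intro!: A defect_tangent tank)
  have integrable: "g \<epsilon> integrable_on cbox 0 1"
    if "continuous_on ?S (\<lambda>z. g (fst z) (snd z))" "\<epsilon> \<in> U" for g :: "real \<Rightarrow> real \<Rightarrow> real" and \<epsilon>
  proof -
    have "continuous_on {0..1} (\<lambda>t. (\<lambda>z. g (fst z) (snd z)) (\<epsilon>, t))"
      by (rule continuous_on_compose2[OF that(1)]) (use that(2) in \<open>auto intro!: continuous_intros\<close>)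
    then show ?thesis by (simp add: integrable_continuous_interval)
  qed
  have d01: "((\<lambda>\<epsilon>. f0 \<epsilon> t) has_real_derivative f1 \<epsilon> t) (at \<epsilon>)"
    and d12: "((\<lambda>\<epsilon>. f1 \<epsilon> t) has_real_derivative f2 \<epsilon> t) (at \<epsilon>)" if "\<epsilon> \<in> U" "t \<in> cbox 0 1" for \<epsilon> t
    using energy_line_derivatives[of "\<rho> t" \<epsilon> "k t" "velocity \<rho> t" "velocity k t"] A[of \<epsilon> t] tan tank that
    unfolding f0_def f1_def f2_def A_def V_def by auto
  have leibniz: "((\<lambda>\<epsilon>. integral {0..1} (g \<epsilon>)) has_real_derivative integral {0..1} (g' \<epsilon>)) (at \<epsilon>)"
    if deriv: "\<And>\<epsilon> t. \<epsilon> \<in> U \<Longrightarrow> t \<in> cbox 0 1 \<Longrightarrow> ((\<lambda>\<epsilon>. g \<epsilon> t) has_real_derivative g' \<epsilon> t) (at \<epsilon>)"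
      and g: "continuous_on ?S (\<lambda>z. g (fst z) (snd z))"
      and g': "continuous_on ?S (\<lambda>z. g' (fst z) (snd z))" and \<epsilon>: "\<epsilon> \<in> U"
    for g g' :: "real \<Rightarrow> real \<Rightarrow> real" and \<epsilon>
  proof -
    have "((\<lambda>\<epsilon>. integral (cbox 0 1) (g \<epsilon>)) has_field_derivative integral (cbox 0 1) (g' \<epsilon>)) (at \<epsilon> within U)"
    proof (rule leibniz_rule_field_derivative)
      show "((\<lambda>x. g x t) has_field_derivative g' x t) (at x within U)" if "x \<in> U" "t \<in> cbox 0 1" for x t
        using deriv[OF that] by (rule has_field_derivative_at_within)
      show "continuous_on (U \<times> cbox 0 1) (\<lambda>(x, t). g' x t)"
        using g' by (simp add: case_prod_unfold)
    qed (use \<epsilon> U integrable[OF g] in auto)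
    then show ?thesis using at_within_open[OF \<epsilon> U(1)] by simp
  qed
  have energy: "energy E \<omega> (\<lambda>t. \<rho> t + \<epsilon> *\<^sub>R k t) = integral {0..1} (f0 \<epsilon>)" for \<epsilon>
    unfolding energy_def f0_def A_def V_def
    by (rule Henstock_Kurzweil_Integration.integral_cong) (simp add: velocity_line[OF \<rho> k])
  have "second_variation E \<omega> \<rho> k = integral {0..1} (f2 0)"
    unfolding second_variation_def energy
    using leibniz[OF d01 c0 c1] leibniz[OF d12 c1 c2 U(2)] by (rule second_deriv_eqI[OF U(1,2)])
  moreover have "(f2 0 has_integral integral {0..1} (f2 0)) {0..1}"
    using integrable[OF c2 U(2)] by (simp add: integrable_integral)
  moreover have "second_variation_density E \<omega> \<rho> t (k t) (velocity k t) = f2 0 t" if "t \<in> {0..1}" for t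
    using second_variation_density_eq[OF pos tan tank] that by (simp add: f2_def A_def V_def)
  ultimately show "((\<lambda>t. second_variation_density E \<omega> \<rho> t (k t) (velocity k t)) has_integral
      second_variation E \<omega> \<rho> k) {0..1}"
    by (metis (no_types, lifting) has_integral_cong)
qed

lemma deriv_quadratic_potential:
  assumes a: "a \<in> positive_orthant" and d: "d \<in> tangent_space" and e: "e \<in> tangent_space"
  shows "deriv (\<lambda>\<epsilon>. (d + \<epsilon> *\<^sub>R e) \<bullet> potential a (d + \<epsilon> *\<^sub>R e)) 0 = 2 * (e \<bullet> potential a d)"
proof -
  have "(d + \<epsilon> *\<^sub>R e) \<bullet> potential a (d + \<epsilon> *\<^sub>R e)
      = d \<bullet> potential a d + \<epsilon> * (2 * (e \<bullet> potential a d)) + \<epsilon>\<^sup>2 * (e \<bullet> potential a e)" for \<epsilon>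
    using potential_selfadjoint[OF a d e]
    by (simp add: linear_add[OF potential_linear] linear_scale[OF potential_linear]
        inner_add_left inner_add_right power2_eq_square algebra_simps)
  then show ?thesis
    by (simp only:) (rule DERIV_imp_deriv, auto intro!: derivative_eq_intros)
qed

lemma deriv_index_density:
  assumes a: "a \<in> positive_orthant" and w: "w \<in> tangent_space" and \<sigma>: "\<sigma> \<in> tangent_space"
  shows "deriv (\<lambda>\<epsilon>. index_density a v x (w + \<epsilon> *\<^sub>R \<sigma>)) 0 = 2 * (\<sigma> \<bullet> potential a (defect a v x w))"
    and "deriv (\<lambda>\<epsilon>. index_density a v (x + \<epsilon> *\<^sub>R \<sigma>) w) 0
      = - 2 * ((L \<sigma> *v potential a v) \<bullet> potential a (defect a v x w))"
proof -
  have dir: "defect a v x (w + \<epsilon> *\<^sub>R \<sigma>) = defect a v x w + \<epsilon> *\<^sub>R \<sigma>" for \<epsilon>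
    by (simp add: defect_def)
  show "deriv (\<lambda>\<epsilon>. index_density a v x (w + \<epsilon> *\<^sub>R \<sigma>)) 0 = 2 * (\<sigma> \<bullet> potential a (defect a v x w))"
    unfolding index_density_def dir by (rule deriv_quadratic_potential[OF a defect_tangent[OF w] \<sigma>])
  have pt: "defect a v (x + \<epsilon> *\<^sub>R \<sigma>) w = defect a v x w + \<epsilon> *\<^sub>R (- (L \<sigma> *v potential a v))" for \<epsilon>
    by (simp add: defect_def L_add_scale)
  have "- (L \<sigma> *v potential a v) \<in> tangent_space"
    using tangent_scale[OF L_tangent, of "-1"] by simp
  from deriv_quadratic_potential[OF a defect_tangent[OF w] this]
  show "deriv (\<lambda>\<epsilon>. index_density a v (x + \<epsilon> *\<^sub>R \<sigma>) w) 0
      = - 2 * ((L \<sigma> *v potential a v) \<bullet> potential a (defect a v x w))"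
    unfolding index_density_def pt by simp
qed

text \<open>The momentum conjugate to \<open>h\<close> is \<open>2 \<Psi>\<close>; the common factor 2 on both sides of the
  Euler--Lagrange equation is cancelled.\<close>

lemma euler_lagrange_second_variation:
  fixes \<rho> h :: "real \<Rightarrow> real ^ 'n"
  defines "\<Phi> \<equiv> \<lambda>t. potential (\<rho> t) (velocity \<rho> t)"
  defines "\<Psi> \<equiv> \<lambda>t. potential (\<rho> t) (defect (\<rho> t) (velocity \<rho> t) (h t) (velocity h t))"
  assumes pos: "\<And>t. t \<in> {0..1} \<Longrightarrow> \<rho> t \<in> positive_orthant"
    and tan: "\<And>t. t \<in> {0..1} \<Longrightarrow> velocity \<rho> t \<in> tangent_space"
    and tanh: "\<And>t. t \<in> {0..1} \<Longrightarrow> velocity h t \<in> tangent_space"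
  shows "euler_lagrange (second_variation_density E \<omega> \<rho>) h \<longleftrightarrow>
    (\<forall>t\<in>{0..1}. \<forall>\<sigma>\<in>tangent_space.
      ((\<lambda>s. \<sigma> \<bullet> \<Psi> s) has_real_derivative - ((L \<sigma> *v \<Phi> t) \<bullet> \<Psi> t)) (at t within {0..1}))"
proof -
  let ?F = "second_variation_density E \<omega> \<rho>"
  have "((\<lambda>s. deriv (\<lambda>\<epsilon>. ?F s (h s) (velocity h s + \<epsilon> *\<^sub>R \<sigma>)) 0) has_real_derivative
           deriv (\<lambda>\<epsilon>. ?F t (h t + \<epsilon> *\<^sub>R \<sigma>) (velocity h t)) 0) (at t within {0..1}) \<longleftrightarrow>
        ((\<lambda>s. \<sigma> \<bullet> \<Psi> s) has_real_derivative - ((L \<sigma> *v \<Phi> t) \<bullet> \<Psi> t)) (at t within {0..1})"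
    (is "(?p has_real_derivative ?f) _ \<longleftrightarrow> _")
    if t: "t \<in> {0..1}" and \<sigma>: "\<sigma> \<in> tangent_space" for t \<sigma>
  proof -
    have p: "?p s = 2 * (\<sigma> \<bullet> \<Psi> s)" if s: "s \<in> {0..1}" for s
    proof -
      have "velocity h s + \<epsilon> *\<^sub>R \<sigma> \<in> tangent_space" for \<epsilon>
        using tanh[OF s] \<sigma> by (intro tangent_add tangent_scale)
      then show ?thesis
        unfolding \<Psi>_def
        by (simp add: second_variation_density_eq[OF pos[OF s] tan[OF s]]
            deriv_index_density(1)[OF pos[OF s] tanh[OF s] \<sigma>])
    qed
    have f: "?f = - 2 * ((L \<sigma> *v \<Phi> t) \<bullet> \<Psi> t)"
      unfolding \<Psi>_def \<Phi>_def
      by (simp add: second_variation_density_eq[OF pos[OF t] tan[OF t] tanh[OF t]]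
          deriv_index_density(2)[OF pos[OF t] tanh[OF t] \<sigma>])
    have "(?p has_real_derivative ?f) (at t within {0..1}) \<longleftrightarrow>
        ((\<lambda>s. 2 * (\<sigma> \<bullet> \<Psi> s)) has_real_derivative 2 * - ((L \<sigma> *v \<Phi> t) \<bullet> \<Psi> t)) (at t within {0..1})"
      unfolding f mult_minus_left mult_minus_right
    proof (rule has_field_derivative_cong_eventually)
      show "\<forall>\<^sub>F s in at t within {0..1}. ?p s = 2 * (\<sigma> \<bullet> \<Psi> s)"
        using p by (auto simp: eventually_at_filter)
    qed (rule p[OF t])
    also have "\<dots> \<longleftrightarrow> ((\<lambda>s. \<sigma> \<bullet> \<Psi> s) has_real_derivative - ((L \<sigma> *v \<Phi> t) \<bullet> \<Psi> t)) (at t within {0..1})"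
      using DERIV_cmult[of "\<lambda>s. \<sigma> \<bullet> \<Psi> s" "- ((L \<sigma> *v \<Phi> t) \<bullet> \<Psi> t)" t "{0..1}" 2]
        DERIV_cmult[of "\<lambda>s. 2 * (\<sigma> \<bullet> \<Psi> s)" "2 * - ((L \<sigma> *v \<Phi> t) \<bullet> \<Psi> t)" t "{0..1}" "1/2"] by auto
    finally show ?thesis .
  qed
  then show ?thesis unfolding euler_lagrange_def by blast
qed

text \<open>The weak derivative of \<open>\<Psi>\<close>, tested only against constant tangent vectors, suffices for a product
  rule with a moving tangent vector.  Since \<open>\<Psi>\<close> has mean zero, its coordinates are pairings with the
  tangent vectors \<open>e\<^sub>i - (1/n, \<dots>, 1/n)\<close>, and a mean-zero \<open>h\<close> is the combination of these with
  coefficients \<open>h\<^sub>i\<close>.\<close>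

lemma has_real_derivative_mean_zero_product:
  fixes h \<Psi> :: "real \<Rightarrow> real ^ 'n" and h' :: "real ^ 'n"
  assumes \<Psi>: "\<And>s. s \<in> {0..1} \<Longrightarrow> \<Psi> s \<in> tangent_space" and t: "t \<in> {0..1}"
    and h: "\<And>s. s \<in> {0..1} \<Longrightarrow> h s \<in> tangent_space"
    and dh: "(h has_vector_derivative h') (at t within {0..1})"
    and "linear f"
    and d\<Psi>: "\<And>\<sigma>. \<sigma> \<in> tangent_space \<Longrightarrow>
      ((\<lambda>s. \<sigma> \<bullet> \<Psi> s) has_real_derivative f \<sigma>) (at t within {0..1})"
  shows "((\<lambda>s. h s \<bullet> \<Psi> s) has_real_derivative h' \<bullet> \<Psi> t + f (h t)) (at t within {0..1})"
proof -
  define \<sigma> where "\<sigma> = (\<lambda>i. axis i 1 - (1 / real CARD('n)) *\<^sub>R (\<chi> j. 1) :: real ^ 'n)"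
  have \<sigma>: "\<sigma> i \<in> tangent_space" for i
    by (simp add: \<sigma>_def tangent_space_def sum_subtractf axis_def)
  have coord: "\<sigma> i \<bullet> \<Psi> s = \<Psi> s $ i" if "s \<in> {0..1}" for i s
    using \<Psi>[OF that]
    by (simp add: \<sigma>_def inner_diff_left inner_axis' tangent_space_def) (simp add: inner_vec_def)
  have expand: "(\<Sum>i\<in>UNIV. h t $ i *\<^sub>R \<sigma> i) = h t"
    using h[OF t] by (simp add: \<sigma>_def tangent_space_def vec_eq_iff axis_def algebra_simps
        sum_subtractf if_distrib flip: sum_divide_distrib cong: if_cong)
  have "((\<lambda>s. h s $ i) has_real_derivative h' $ i) (at t within {0..1})" for i
    using bounded_linear.has_vector_derivative[OF bounded_linear_vec_nth dh]
    by (simp add: has_real_derivative_iff_has_vector_derivative)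
  then have "((\<lambda>s. \<Sum>i\<in>UNIV. h s $ i * (\<sigma> i \<bullet> \<Psi> s)) has_real_derivative
      (\<Sum>i\<in>UNIV. h' $ i * (\<sigma> i \<bullet> \<Psi> t) + f (\<sigma> i) * h t $ i)) (at t within {0..1})"
    by (intro DERIV_sum DERIV_mult d\<Psi> \<sigma>)
  moreover have "(\<Sum>i\<in>UNIV. h' $ i * (\<sigma> i \<bullet> \<Psi> t) + f (\<sigma> i) * h t $ i) = h' \<bullet> \<Psi> t + f (h t)"
  proof -
    have "f (h t) = (\<Sum>i\<in>UNIV. h t $ i *\<^sub>R f (\<sigma> i))"
      by (subst expand[symmetric]) (simp only: linear_sum[OF \<open>linear f\<close>] linear_scale[OF \<open>linear f\<close>])
    then show ?thesis
      by (simp only: coord[OF t] sum.distrib) (simp add: inner_vec_def mult.commute)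
  qed
  ultimately have "((\<lambda>s. \<Sum>i\<in>UNIV. h s $ i * (\<sigma> i \<bullet> \<Psi> s)) has_real_derivative
      h' \<bullet> \<Psi> t + f (h t)) (at t within {0..1})" by simp
  moreover have "(\<Sum>i\<in>UNIV. h s $ i * (\<sigma> i \<bullet> \<Psi> s)) = h s \<bullet> \<Psi> s" if "s \<in> {0..1}" for s
    by (simp only: coord[OF that]) (simp add: inner_vec_def)
  ultimately show ?thesis
    using t by (auto intro: has_field_derivative_transform_within[where d = 1])
qed

text \<open>The monotonicity argument: \<open>h \<bullet> \<Psi>\<close> has derivative \<open>\<Psi> \<bullet> L(\<rho>) \<Psi> \<ge> 0\<close> and equal values at both ends.\<close>

lemma euler_lagrange_second_variation_iff_defect_eq_0:
  fixes \<rho> h :: "real \<Rightarrow> real ^ 'n"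
  assumes pos: "\<And>t. t \<in> {0..1} \<Longrightarrow> \<rho> t \<in> positive_orthant"
    and tan: "\<And>t. t \<in> {0..1} \<Longrightarrow> velocity \<rho> t \<in> tangent_space"
    and h: "admissible_variation h"
  shows "euler_lagrange (second_variation_density E \<omega> \<rho>) h \<longleftrightarrow>
    (\<forall>t\<in>{0..1}. defect (\<rho> t) (velocity \<rho> t) (h t) (velocity h t) = 0)"
proof -
  define \<Phi> where "\<Phi> = (\<lambda>t. potential (\<rho> t) (velocity \<rho> t))"
  define w where "w = (\<lambda>t. defect (\<rho> t) (velocity \<rho> t) (h t) (velocity h t))"
  define \<Psi> where "\<Psi> = (\<lambda>t. potential (\<rho> t) (w t))"
  have smooth: "smooth_curve h" and h_tan: "\<And>t. t \<in> {0..1} \<Longrightarrow> h t \<in> tangent_space"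
    and ends: "h 0 = 0" "h 1 = 0"
    using h unfolding admissible_variation_def by auto
  have tanh: "velocity h t \<in> tangent_space" if "t \<in> {0..1}" for t
    using velocity_tangent[OF smooth _ that] h_tan unfolding tangent_space_def by blast
  have EL: "euler_lagrange (second_variation_density E \<omega> \<rho>) h \<longleftrightarrow>
    (\<forall>t\<in>{0..1}. \<forall>\<sigma>\<in>tangent_space.
      ((\<lambda>s. \<sigma> \<bullet> \<Psi> s) has_real_derivative - ((L \<sigma> *v \<Phi> t) \<bullet> \<Psi> t)) (at t within {0..1}))"
    unfolding \<Psi>_def \<Phi>_def w_def by (rule euler_lagrange_second_variation) (fact pos tan tanh)+
  have "(\<forall>t\<in>{0..1}. \<forall>\<sigma>\<in>tangent_space.
      ((\<lambda>s. \<sigma> \<bullet> \<Psi> s) has_real_derivative - ((L \<sigma> *v \<Phi> t) \<bullet> \<Psi> t)) (at t within {0..1})) \<longleftrightarrow>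
    (\<forall>t\<in>{0..1}. w t = 0)"
  proof
    assume momentum: "\<forall>t\<in>{0..1}. \<forall>\<sigma>\<in>tangent_space.
      ((\<lambda>s. \<sigma> \<bullet> \<Psi> s) has_real_derivative - ((L \<sigma> *v \<Phi> t) \<bullet> \<Psi> t)) (at t within {0..1})"
    define g where "g = (\<lambda>t. h t \<bullet> \<Psi> t)"
    define q where "q = (\<lambda>t. \<Psi> t \<bullet> (L (\<rho> t) *v \<Psi> t))"
    have w\<Psi>: "L (\<rho> t) *v \<Psi> t = w t" and tan\<Psi>: "\<Psi> t \<in> tangent_space" if "t \<in> {0..1}" for t
      unfolding \<Psi>_def w_def
      using that by (auto intro!: L_potential potential_tangent defect_tangent pos tanh)
    have dg: "(g has_real_derivative q t) (at t within {0..1})" if t: "t \<in> {0..1}" for t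
    proof -
      have lin: "linear (\<lambda>\<sigma>. - ((L \<sigma> *v \<Phi> t) \<bullet> \<Psi> t))"
        by (intro linearI)
          (simp_all add: linear_add[OF L_linear] linear_scale[OF L_linear] inner_add_left)
      have "(g has_real_derivative velocity h t \<bullet> \<Psi> t + - ((L (h t) *v \<Phi> t) \<bullet> \<Psi> t)) (at t within {0..1})"
        unfolding g_def using momentum t
        by (intro has_real_derivative_mean_zero_product[OF tan\<Psi> t h_tan
              smooth_curve_velocity(1)[OF smooth t] lin]) auto
      moreover have "velocity h t \<bullet> \<Psi> t + - ((L (h t) *v \<Phi> t) \<bullet> \<Psi> t) = q t"
        unfolding q_def w\<Psi>[OF t] by (simp add: w_def defect_def \<Phi>_def inner_diff_left inner_commute[of "\<Psi> t"])
      ultimately show ?thesis by simp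
    qed
    have q_nonneg: "q t \<ge> 0" if "t \<in> {0..1}" for t
      unfolding q_def by (rule L_form_nonneg[OF pos[OF that]])
    have cont: "continuous_on {0..1} g"
      using dg by (blast intro: DERIV_continuous_on)
    have mono: "g x \<le> g y" if "0 \<le> x" "x \<le> y" "y \<le> 1" for x y
    proof (rule DERIV_nonneg_imp_increasing_open[OF that(2)])
      show "continuous_on {x..y} g" by (rule continuous_on_subset[OF cont]) (use that in auto)
      fix z assume z: "x < z" "z < y"
      then have "(g has_real_derivative q z) (at z)"
        using dg[of z] that at_within_Icc_at[of 0 z 1] by auto
      then show "\<exists>d. (g has_real_derivative d) (at z) \<and> 0 \<le> d"
        using q_nonneg[of z] z that by auto
    qed
    have g0: "g t = 0" if "t \<in> {0..1}" for t
      using mono[of 0 t] mono[of t 1] that ends by (simp add: g_def)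
    show "\<forall>t\<in>{0..1}. w t = 0"
    proof
      fix t :: real assume t: "t \<in> {0..1}"
      have "(g has_real_derivative 0) (at t within {0..1})"
        by (rule has_field_derivative_transform_within[OF DERIV_const zero_less_one t]) (simp add: g0)
      moreover have "at t within {0..1} \<noteq> bot"
        using t by (metis islimpt_Icc trivial_limit_within zero_less_one)
      ultimately have "q t = 0"
        using dg[OF t] has_field_derivative_unique by blast
      then have "\<Psi> t = 0"
        unfolding q_def by (rule L_definite[OF pos[OF t] tan\<Psi>[OF t]])
      then show "w t = 0" using w\<Psi>[OF t] by simp
    qed
  next
    assume "\<forall>t\<in>{0..1}. w t = 0"
    then have \<Psi>0: "\<Psi> t = 0" if "t \<in> {0..1}" for t
      using that by (simp add: \<Psi>_def linear_0[OF potential_linear])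
    show "\<forall>t\<in>{0..1}. \<forall>\<sigma>\<in>tangent_space.
      ((\<lambda>s. \<sigma> \<bullet> \<Psi> s) has_real_derivative - ((L \<sigma> *v \<Phi> t) \<bullet> \<Psi> t)) (at t within {0..1})"
    proof (intro ballI)
      fix t :: real and \<sigma> :: "real ^ 'n" assume t: "t \<in> {0..1}"
      have "((\<lambda>s. \<sigma> \<bullet> \<Psi> s) has_real_derivative 0) (at t within {0..1})"
        by (rule has_field_derivative_transform_within[OF DERIV_const zero_less_one t]) (simp add: \<Psi>0)
      then show "((\<lambda>s. \<sigma> \<bullet> \<Psi> s) has_real_derivative - ((L \<sigma> *v \<Phi> t) \<bullet> \<Psi> t)) (at t within {0..1})"
        by (simp add: \<Psi>0[OF t])
    qed
  qed
  then show ?thesis unfolding EL by (simp only: w_def)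
qed

end

theorem theorem2:
  fixes E :: "('n::finite \<times> 'n) set"
    and \<omega> :: "'n \<Rightarrow> 'n \<Rightarrow> real"
    and \<rho> h :: "real \<Rightarrow> real ^ 'n"
    and \<rho>0 \<rho>1 :: "real ^ 'n"
  assumes "weighted_graph E \<omega>"
    and "connected_graph E"
    and "geodesic_W E \<omega> \<rho>"
    and "\<rho> 0 = \<rho>0" and "\<rho> 1 = \<rho>1"
    and "smooth_curve h"
    and "\<forall>t\<in>{0..1}. (\<Sum>i\<in>UNIV. h t $ i) = 0"
    and "h 0 = 0" and "h 1 = 0"
  shows "jacobi_equation E \<omega> \<rho> h \<longleftrightarrow>
    (\<forall>t\<in>{0..1}. velocity h t -
       laplacian E \<omega> (h t) *v (pinv (laplacian E \<omega> (\<rho> t)) *v velocity \<rho> t) = 0)"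
proof -
  interpret connected_weighted_graph E \<omega>
    using assms by unfold_locales
  have smooth: "smooth_curve \<rho>" and simplex: "\<And>t. t \<in> {0..1} \<Longrightarrow> \<rho> t \<in> simplex_pos"
    using assms(3) unfolding geodesic_W_def by auto
  have pos: "\<rho> t \<in> positive_orthant" if "t \<in> {0..1}" for t
    using simplex[OF that] by (simp add: simplex_pos_def positive_orthant_def)
  have tan: "velocity \<rho> t \<in> tangent_space" if "t \<in> {0..1}" for t
    using velocity_tangent[OF smooth _ that] simplex unfolding simplex_pos_def by blast
  have "admissible_variation h"
    using assms unfolding admissible_variation_def tangent_space_def by simp
  from euler_lagrange_second_variation_iff_defect_eq_0[OF pos tan this]
  show ?thesis
    unfolding jacobi_equation_def defect_def potential_def
    using second_variation_lagrangian[OF smooth pos tan] by simp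
qed

end
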